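(* Let $F$ be a recursively enumerable formal system and let $\mathcal{G}_F$ be as in the context. Then $\mathcal{G}_F$ is a computable function class, i.e., there is a total computable function $G_F:\mathbb{N}\times\mathbb{N}\to\{0,1\}$ with $\mathcal{G}_F=\{n\mapsto G_F(m,n): m\in\mathbb{N}\}$.
   Context: Let $\mathbb{N}=\{0,1,2,\dots\}$. Fix a Gödel numbering of statements of the formal system $F$ such that translating between statements and Gödel numbers, and forming negations, is primitive recursive. $F$ is recursively enumerable if there is a primitive recursive $\varphi:\mathbb{N}\to\mathbb{N}$ whose range is exactly the set of Gödel numbers of statements provable in $F$; fix such $\varphi$. Standing assumption: infinitely many different theorems are provable in $F$. Let $E^2:\mathbb{N}\to\mathbb{N}\times\mathbb{N}$ be a bijection with primitive recursive components $E^2_1,E^2_2$ and primitive recursive inverse. Let $c_c(\{0,1\})$ be the set of finitely supported $a:\mathbb{N}\to\{0,1\}$. For such $a$ let $g_a(n)=a(n)$ if the statement with Gödel number $\varphi(E^2_1(n))$ is the negation of the statement with Gödel number $\varphi(E^2_2(n))$, and $g_a(n)=0$ otherwise; $\mathcal{G}_F=\{g_a: a\in c_c(\{0,1\})\}$. *)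

theory Defs
  imports "HOL-Library.Nat_Bijection"
begin

section \<open>Primitive recursive and computable functions\<close>

text \<open>Programs for the partial recursive functions. \<open>Zero\<close> is the constant 0 of every arity,
  \<open>Proj i\<close> selects the argument with (0-based) index \<open>i\<close>, and both recursion and minimization
  act on the first argument.\<close>

datatype recf =
    Zero
  | Succ
  | Proj nat
  | Comp recf "recf list"
  | Prec recf recf
  | Mu recf

fun has_arity :: "recf \<Rightarrow> nat \<Rightarrow> bool" where
  "has_arity Zero n \<longleftrightarrow> True"
| "has_arity Succ n \<longleftrightarrow> n = 1"
| "has_arity (Proj i) n \<longleftrightarrow> i < n"
| "has_arity (Comp f gs) n \<longleftrightarrow> has_arity f (length gs) \<and> (\<forall>g\<in>set gs. has_arity g n)"
| "has_arity (Prec f g) n \<longleftrightarrow> (\<exists>k. n = Suc k \<and> has_arity f k \<and> has_arity g (k + 2))"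
| "has_arity (Mu f) n \<longleftrightarrow> has_arity f (Suc n)"

fun mu_free :: "recf \<Rightarrow> bool" where
  "mu_free (Comp f gs) \<longleftrightarrow> mu_free f \<and> (\<forall>g\<in>set gs. mu_free g)"
| "mu_free (Prec f g) \<longleftrightarrow> mu_free f \<and> mu_free g"
| "mu_free (Mu f) \<longleftrightarrow> False"
| "mu_free _ \<longleftrightarrow> True"

text \<open>\<open>evaluates p xs y\<close>: the program \<open>p\<close> halts on the arguments \<open>xs\<close> with value \<open>y\<close>.\<close>

inductive evaluates :: "recf \<Rightarrow> nat list \<Rightarrow> nat \<Rightarrow> bool" where
  eval_Zero: "evaluates Zero xs 0"
| eval_Succ: "evaluates Succ [x] (Suc x)"
| eval_Proj: "i < length xs \<Longrightarrow> evaluates (Proj i) xs (xs ! i)"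
| eval_Comp: "list_all2 (\<lambda>g y. evaluates g xs y) gs ys \<Longrightarrow> evaluates f ys z \<Longrightarrow>
    evaluates (Comp f gs) xs z"
| eval_Prec_0: "evaluates f xs y \<Longrightarrow> evaluates (Prec f g) (0 # xs) y"
| eval_Prec_Suc: "evaluates (Prec f g) (n # xs) y \<Longrightarrow> evaluates g (n # y # xs) z \<Longrightarrow>
    evaluates (Prec f g) (Suc n # xs) z"
| eval_Mu: "evaluates f (n # xs) 0 \<Longrightarrow> (\<forall>m<n. \<exists>y. evaluates f (m # xs) (Suc y)) \<Longrightarrow>
    evaluates (Mu f) xs n"

lemma evaluates_deterministic:
  assumes "evaluates p xs y" and "evaluates p xs z"
  shows "y = z"
  using assms
proof (induction arbitrary: z rule: evaluates.induct)
  case (eval_Comp xs gs ys f w)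
  from eval_Comp.prems obtain ys' where
    ys': "list_all2 (\<lambda>g y. evaluates g xs y) gs ys'" "evaluates f ys' z"
    by (cases rule: evaluates.cases) auto
  have "ys = ys'"
    using eval_Comp.IH(1) ys'(1) by (auto simp: list_all2_conv_all_nth intro!: nth_equalityI)
  then show ?case using eval_Comp.IH ys'(2) by blast
next
  case (eval_Prec_0 f xs y g)
  from eval_Prec_0.prems have "evaluates f xs z" by (cases rule: evaluates.cases) auto
  then show ?case using eval_Prec_0.IH by blast
next
  case (eval_Prec_Suc f g n xs y w)
  from eval_Prec_Suc.prems obtain y' where
    "evaluates (Prec f g) (n # xs) y'" "evaluates g (n # y' # xs) z"
    by (cases rule: evaluates.cases) auto
  then show ?case using eval_Prec_Suc.IH by blast
next
  case (eval_Mu f n xs)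
  from eval_Mu.prems have z: "evaluates f (z # xs) 0" "\<forall>m<z. \<exists>y. evaluates f (m # xs) (Suc y)"
    by (auto elim: evaluates.cases)
  have "\<not> z < n"
    using eval_Mu.IH(2) z(1) by blast
  moreover have "\<not> n < z"
    using eval_Mu.IH(1) z(2) by blast
  ultimately show ?case by simp
qed (auto elim: evaluates.cases)

definition computes :: "recf \<Rightarrow> nat \<Rightarrow> (nat list \<Rightarrow> nat) \<Rightarrow> bool" where
  "computes p k f \<longleftrightarrow> has_arity p k \<and> (\<forall>xs. length xs = k \<longrightarrow> evaluates p xs (f xs))"

definition primitive_recursive1 :: "(nat \<Rightarrow> nat) \<Rightarrow> bool" where
  "primitive_recursive1 f \<longleftrightarrow> (\<exists>p. mu_free p \<and> computes p 1 (\<lambda>xs. f (xs ! 0)))"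

definition primitive_recursive2 :: "(nat \<Rightarrow> nat \<Rightarrow> nat) \<Rightarrow> bool" where
  "primitive_recursive2 f \<longleftrightarrow> (\<exists>p. mu_free p \<and> computes p 2 (\<lambda>xs. f (xs ! 0) (xs ! 1)))"

definition total_computable2 :: "(nat \<Rightarrow> nat \<Rightarrow> nat) \<Rightarrow> bool" where
  "total_computable2 f \<longleftrightarrow> (\<exists>p. computes p 2 (\<lambda>xs. f (xs ! 0) (xs ! 1)))"

definition computable_function_class :: "(nat \<Rightarrow> nat) set \<Rightarrow> bool" where
  "computable_function_class \<F> \<longleftrightarrow>
    (\<exists>G. total_computable2 G \<and> (\<forall>m n. G m n \<in> {0, 1}) \<and> \<F> = {(\<lambda>n. G m n) | m. True})"


section \<open>Formal systems with a Goedel numbering\<close>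

text \<open>Statements are words over an alphabet whose symbols are numbered 0, 1, 2, \<dots>. Any set of
  statements may be the set of provable ones; how proofs are formed plays no role.\<close>

type_synonym word = "nat list"

record formal_system =
  statements :: "word set"
  negation :: "word \<Rightarrow> word"
  theorems :: "word set"

definition formal_system :: "formal_system \<Rightarrow> bool" where
  "formal_system F \<longleftrightarrow>
    negation F ` statements F \<subseteq> statements F \<and> theorems F \<subseteq> statements F"

text \<open>Primitive recursiveness of the translations \<open>s \<mapsto> gn s\<close> and \<open>gn s \<mapsto> s\<close> is expressed by
  representing a word by its standard code \<^const>\<open>list_encode\<close>; negation is expressed on Goedel
  numbers. Nothing is required of the translating functions on numbers that do not represent
  a statement.\<close>

definition goedel_numbering :: "formal_system \<Rightarrow> (word \<Rightarrow> nat) \<Rightarrow> bool" where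
  "goedel_numbering F gn \<longleftrightarrow>
    inj_on gn (statements F) \<and>
    (\<exists>enc. primitive_recursive1 enc \<and> (\<forall>s\<in>statements F. enc (list_encode s) = gn s)) \<and>
    (\<exists>dec. primitive_recursive1 dec \<and> (\<forall>s\<in>statements F. dec (gn s) = list_encode s)) \<and>
    (\<exists>neg. primitive_recursive1 neg \<and> (\<forall>s\<in>statements F. neg (gn s) = gn (negation F s)))"

definition statement_of :: "formal_system \<Rightarrow> (word \<Rightarrow> nat) \<Rightarrow> nat \<Rightarrow> word" where
  "statement_of F gn = inv_into (statements F) gn"

definition enumerates_theorems :: "formal_system \<Rightarrow> (word \<Rightarrow> nat) \<Rightarrow> (nat \<Rightarrow> nat) \<Rightarrow> bool" where
  "enumerates_theorems F gn \<phi> \<longleftrightarrow> primitive_recursive1 \<phi> \<and> range \<phi> = gn ` theorems F"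

definition primitive_recursive_pairing :: "(nat \<Rightarrow> nat \<times> nat) \<Rightarrow> bool" where
  "primitive_recursive_pairing E \<longleftrightarrow> bij E \<and>
    primitive_recursive1 (\<lambda>n. fst (E n)) \<and> primitive_recursive1 (\<lambda>n. snd (E n)) \<and>
    primitive_recursive2 (\<lambda>x y. inv E (x, y))"


section \<open>The function class of a recursively enumerable formal system\<close>

definition finitely_supported_01 :: "(nat \<Rightarrow> nat) set" where
  "finitely_supported_01 = {a. range a \<subseteq> {0, 1} \<and> finite {n. a n \<noteq> 0}}"

definition g_fun :: "formal_system \<Rightarrow> (word \<Rightarrow> nat) \<Rightarrow> (nat \<Rightarrow> nat) \<Rightarrow> (nat \<Rightarrow> nat \<times> nat) \<Rightarrow>
    (nat \<Rightarrow> nat) \<Rightarrow> nat \<Rightarrow> nat" where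
  "g_fun F gn \<phi> E a n =
    (if statement_of F gn (\<phi> (fst (E n))) = negation F (statement_of F gn (\<phi> (snd (E n))))
     then a n else 0)"

definition G_class :: "formal_system \<Rightarrow> (word \<Rightarrow> nat) \<Rightarrow> (nat \<Rightarrow> nat) \<Rightarrow> (nat \<Rightarrow> nat \<times> nat) \<Rightarrow>
    (nat \<Rightarrow> nat) set" where
  "G_class F gn \<phi> E = {g_fun F gn \<phi> E a | a. a \<in> finitely_supported_01}"

end

theory Submission
  imports Defs
begin

text \<open>Code the finitely supported 0-1 sequences by the binary expansions of natural numbers.
  Provable statements are in the range of the numbering, so whether the first of two provable
  statements is the negation of the second can be decided by comparing the number of the first with
  the primitive recursive negation of the number of the second. Hence the function that maps
  \<open>(m, n)\<close> to the \<open>n\<close>-th binary digit of \<open>m\<close>, or to 0 if this test fails at \<open>n\<close>, is computable.\<close>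

text \<open>Programs have varying arity because primitive recursion raises it. Only lists of length
  \<open>k\<close> matter, so \<open>computable_cong\<close> may change a function freely
  elsewhere.\<close>

definition computable :: "nat \<Rightarrow> (nat list \<Rightarrow> nat) \<Rightarrow> bool" where
  "computable k f \<longleftrightarrow> (\<exists>p. computes p k f)"

lemma computable_cong:
  assumes "computable k f" and "\<And>xs. length xs = k \<Longrightarrow> f xs = g xs"
  shows "computable k g"
  using assms unfolding computable_def computes_def by metis

lemma computable_zero: "computable k (\<lambda>_. 0)"
  unfolding computable_def computes_def by (rule exI[of _ Zero]) (auto intro: eval_Zero)

lemma computable_nth: "i < k \<Longrightarrow> computable k (\<lambda>xs. xs ! i)"
  unfolding computable_def computes_def by (rule exI[of _ "Proj i"]) (auto intro: eval_Proj)

lemma computable_Comp: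
  assumes "computable (length gs) f" and "\<forall>g\<in>set gs. computable k g"
  shows "computable k (\<lambda>xs. f (map (\<lambda>g. g xs) gs))"
proof -
  from assms(1) obtain p where p: "computes p (length gs) f"
    unfolding computable_def by blast
  \<comment> \<open>Choosing a program for each function at once makes \<open>map q gs\<close> the
    list of inner programs.\<close>
  from assms(2) obtain q where q: "\<And>g. g \<in> set gs \<Longrightarrow> computes (q g) k g"
    unfolding computable_def by metis
  have "computes (Comp p (map q gs)) k (\<lambda>xs. f (map (\<lambda>g. g xs) gs))"
    unfolding computes_def
  proof (intro conjI allI impI)
    show "has_arity (Comp p (map q gs)) k"
      using p q by (auto simp: computes_def)
    fix xs :: "nat list"
    assume "length xs = k"
    then show "evaluates (Comp p (map q gs)) xs (f (map (\<lambda>g. g xs) gs))"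
      using p q by (intro eval_Comp[where ys = "map (\<lambda>g. g xs) gs"])
        (auto simp: computes_def list_all2_conv_all_nth)
  qed
  then show ?thesis unfolding computable_def by blast
qed

lemma computable_comp1:
  assumes "computable 1 (\<lambda>xs. h (xs ! 0))" and "computable k f"
  shows "computable k (\<lambda>xs. h (f xs))"
  using computable_Comp[of "[f]" "\<lambda>xs. h (xs ! 0)" k] assms by simp

lemma computable_comp2:
  assumes "computable 2 (\<lambda>xs. h (xs ! 0) (xs ! 1))" and "computable k f" and "computable k g"
  shows "computable k (\<lambda>xs. h (f xs) (g xs))"
  using computable_Comp[of "[f, g]" "\<lambda>xs. h (xs ! 0) (xs ! 1)" k] assms
  by (simp add: numeral_2_eq_2)

lemma computable_Suc: "computable 1 (\<lambda>xs. Suc (xs ! 0))"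
  unfolding computable_def computes_def
proof (intro exI conjI allI impI)
  show "has_arity Succ 1" by simp
  fix xs :: "nat list"
  assume "length xs = 1"
  then obtain x where "xs = [x]" by (auto simp: length_Suc_conv)
  then show "evaluates Succ xs (Suc (xs ! 0))" by (simp add: eval_Succ)
qed

text \<open>Any \<open>h\<close> that satisfies the recursion equations will do, so arithmetic
  functions can be plugged in directly. As in \<open>eval_Prec_Suc\<close>, the step receives the
  counter, the previous value and then the parameters.\<close>

lemma computable_Prec:
  assumes "computable k f" and "computable (k + 2) g"
    and "\<And>xs. h 0 xs = f xs" and "\<And>n xs. h (Suc n) xs = g (n # h n xs # xs)"
  shows "computable (Suc k) (\<lambda>xs. h (hd xs) (tl xs))"
proof -
  from assms(1,2) obtain p q where p: "computes p k f" and q: "computes q (k + 2) g"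
    unfolding computable_def by blast
  have eval: "evaluates (Prec p q) (n # xs) (h n xs)" if "length xs = k" for n xs
  proof (induction n)
    case 0
    show ?case using p that by (auto simp: computes_def assms(3) intro: eval_Prec_0)
  next
    case (Suc n)
    have "evaluates q (n # h n xs # xs) (h (Suc n) xs)"
      using q that by (simp add: computes_def assms(4))
    with Suc show ?case by (rule eval_Prec_Suc)
  qed
  have "computes (Prec p q) (Suc k) (\<lambda>xs. h (hd xs) (tl xs))"
    using p q eval by (auto simp: computes_def length_Suc_conv)
  then show ?thesis unfolding computable_def by blast
qed

lemma computable_rec1:
  assumes "computable 2 (\<lambda>xs. g (xs ! 0) (xs ! 1))"
    and "h 0 = 0" and "\<And>n. h (Suc n) = g n (h n)"
  shows "computable 1 (\<lambda>xs. h (xs ! 0))"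
  using computable_Prec[of 0 "\<lambda>_. 0" "\<lambda>xs. g (xs ! 0) (xs ! 1)" "\<lambda>n _. h n"] assms
  by (auto simp: computable_zero numeral_2_eq_2 length_Suc_conv elim!: computable_cong)

text \<open>The step is not given the parameter \<open>y\<close>, which enters only through the
  starting value. This covers functions obtained by iterating a fixed operation.\<close>

lemma computable_rec2:
  assumes "computable 1 (\<lambda>xs. f (xs ! 0))"
    and "computable 2 (\<lambda>xs. g (xs ! 0) (xs ! 1))"
    and "\<And>y. h 0 y = f y" and "\<And>n y. h (Suc n) y = g n (h n y)"
  shows "computable 2 (\<lambda>xs. h (xs ! 0) (xs ! 1))"
proof -
  \<comment> \<open>\<open>Prec\<close> feeds its step three arguments here, so \<open>g\<close> is
    padded with an ignored third one.\<close>
  have "computable (1 + 2) (\<lambda>xs. g (xs ! 0) (xs ! 1))"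
    by (intro computable_comp2[OF assms(2)] computable_nth) auto
  from computable_Prec[OF assms(1) this, of "\<lambda>n xs. h n (xs ! 0)"]
  have "computable (Suc 1) (\<lambda>xs. h (hd xs) (tl xs ! 0))"
    using assms(3,4) by simp
  then show ?thesis
    by (auto simp: numeral_2_eq_2 length_Suc_conv elim!: computable_cong)
qed

lemma computable_add: "computable 2 (\<lambda>xs. xs ! 0 + xs ! 1)"
  by (rule computable_rec2[where f = "\<lambda>y. y" and g = "\<lambda>_ z. Suc z"])
    (simp_all add: computable_nth computable_comp1[OF computable_Suc] del: One_nat_def)

text \<open>The step returns the counter itself, which is the predecessor of the next
  argument.\<close>

lemma computable_pred: "computable 1 (\<lambda>xs. xs ! 0 - 1)"
  by (rule computable_rec1[where g = "\<lambda>n _. n"]) (auto intro: computable_nth)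

lemma computable_diff: "computable 2 (\<lambda>xs. xs ! 0 - xs ! 1)"
proof -
  \<comment> \<open>Recursion acts on the first argument, so the number subtracted is put there; the
    arguments are swapped back afterwards.\<close>
  have "computable 2 (\<lambda>xs. xs ! 1 - xs ! 0)"
    by (rule computable_rec2[where f = "\<lambda>y. y" and g = "\<lambda>_ z. z - 1" and h = "\<lambda>n y. y - n"])
      (simp_all add: computable_nth computable_comp1[OF computable_pred] del: One_nat_def)
  from computable_comp2[OF this computable_nth[of 1 2] computable_nth[of 0 2]]
  show ?thesis by simp
qed

text \<open>Parity flips at each successor.\<close>

lemma computable_mod2: "computable 1 (\<lambda>xs. xs ! 0 mod 2)"
proof (rule computable_rec1[where g = "\<lambda>_ z. 1 - z"])
  have "computable 2 (\<lambda>_. Suc 0)"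
    by (rule computable_comp1[OF computable_Suc computable_zero])
  then show "computable 2 (\<lambda>xs. 1 - xs ! 1)"
    by (intro computable_comp2[OF computable_diff] computable_nth) simp_all
  show "Suc n mod 2 = 1 - n mod 2" for n by presburger
qed simp

text \<open>The quotient grows by one exactly when passing from an odd number to its
  successor.\<close>

lemma computable_div2: "computable 1 (\<lambda>xs. xs ! 0 div 2)"
proof (rule computable_rec1[where g = "\<lambda>n z. z + n mod 2"])
  show "computable 2 (\<lambda>xs. xs ! 1 + xs ! 0 mod 2)"
    by (intro computable_comp2[OF computable_add] computable_comp1[OF computable_mod2]
        computable_nth) auto
  show "Suc n div 2 = n div 2 + n mod 2" for n by presburger
qed simp

text \<open>Dividing by \<open>2 ^ n\<close> is halving \<open>n\<close> times, so no computable
  power function has to be built.\<close>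

lemma computable_digit: "computable 2 (\<lambda>xs. (xs ! 0 div 2 ^ (xs ! 1)) mod 2)"
proof -
  have "computable 2 (\<lambda>xs. xs ! 1 div 2 ^ (xs ! 0))"
    by (rule computable_rec2[where f = "\<lambda>y. y" and g = "\<lambda>_ z. z div 2"
          and h = "\<lambda>n y. y div 2 ^ n"])
      (simp_all add: computable_nth computable_comp1[OF computable_div2]
        div_mult2_eq mult.commute[of 2] del: One_nat_def)
  from computable_comp2[OF this computable_nth[of 1 2] computable_nth[of 0 2]]
  have "computable 2 (\<lambda>xs. xs ! 0 div 2 ^ (xs ! 1))" by simp
  from computable_comp1[OF computable_mod2 this] show ?thesis by simp
qed

lemma primitive_recursive1_imp_computable:
  "primitive_recursive1 f \<Longrightarrow> computable 1 (\<lambda>xs. f (xs ! 0))"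
  unfolding primitive_recursive1_def computable_def by blast

lemma computable_digit_if_eq:
  assumes "computable 1 (\<lambda>xs. u (xs ! 0))" and "computable 1 (\<lambda>xs. v (xs ! 0))"
  shows "total_computable2 (\<lambda>m n. if u n = v n then (m div 2 ^ n) mod 2 else 0)"
proof -
  have u: "computable 2 (\<lambda>xs. u (xs ! 1))" and v: "computable 2 (\<lambda>xs. v (xs ! 1))"
    by (intro computable_comp1[OF assms(1)] computable_comp1[OF assms(2)] computable_nth; simp)+
  \<comment> \<open>Truncated subtraction replaces the case distinction: the sum of the two
    differences is 0 if the values agree and at least 1 otherwise, which wipes out a digit that is
    at most 1.\<close>
  have "computable 2 (\<lambda>xs. (xs ! 0 div 2 ^ (xs ! 1)) mod 2 -
      ((u (xs ! 1) - v (xs ! 1)) + (v (xs ! 1) - u (xs ! 1))))"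
    by (intro computable_comp2[OF computable_diff] computable_comp2[OF computable_add]
        computable_digit u v)
  then have "computable 2 (\<lambda>xs. if u (xs ! 1) = v (xs ! 1)
      then (xs ! 0 div 2 ^ (xs ! 1)) mod 2 else 0)"
    by (rule computable_cong) auto
  then show ?thesis unfolding computable_def total_computable2_def .
qed

lemma finitely_supported_01_eq_digits:
  "finitely_supported_01 = range (\<lambda>m n. (m div 2 ^ n) mod 2)"
proof (intro equalityI subsetI)
  fix a
  assume "a \<in> finitely_supported_01"
  then have 01: "\<And>n. a n = 0 \<or> a n = 1" and fin: "finite {n. a n \<noteq> 0}"
    unfolding finitely_supported_01_def by blast+
  \<comment> \<open>The code of \<open>a\<close> is the sum of the powers \<open>2 ^ n\<close> over
    its support, which is finite.\<close>
  have "a = (\<lambda>n. (set_encode {n. a n \<noteq> 0} div 2 ^ n) mod 2)"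
  proof
    fix n
    have "odd (set_encode {n. a n \<noteq> 0} div 2 ^ n) \<longleftrightarrow> a n \<noteq> 0"
      using set_encode_inverse[OF fin] by (auto simp: set_decode_def)
    then show "a n = (set_encode {n. a n \<noteq> 0} div 2 ^ n) mod 2"
      using 01[of n] by (auto simp: odd_iff_mod_2_eq_one)
  qed
  then show "a \<in> range (\<lambda>m n. (m div 2 ^ n) mod 2)" by blast
next
  fix a :: "nat \<Rightarrow> nat"
  assume "a \<in> range (\<lambda>m n. (m div 2 ^ n) mod 2)"
  then obtain m where a: "a = (\<lambda>n. (m div 2 ^ n) mod 2)" by blast
  \<comment> \<open>The positions of the digits 1 of \<open>m\<close> form the finite set coded by
    \<open>m\<close>.\<close>
  have "{n. a n \<noteq> 0} = set_decode m"
    by (auto simp: a set_decode_def odd_iff_mod_2_eq_one)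
  then have "finite {n. a n \<noteq> 0}" by simp
  moreover have "range a \<subseteq> {0, 1}" unfolding a by auto
  ultimately show "a \<in> finitely_supported_01" unfolding finitely_supported_01_def by blast
qed

theorem theorem2p12:
  fixes F :: formal_system
    and gn :: "word \<Rightarrow> nat"
    and \<phi> :: "nat \<Rightarrow> nat"
    and E :: "nat \<Rightarrow> nat \<times> nat"
  assumes "formal_system F"
    and "goedel_numbering F gn"
    and "infinite (theorems F)"
    and "enumerates_theorems F gn \<phi>"
    and "primitive_recursive_pairing E"
  shows "computable_function_class (G_class F gn \<phi> E)"
proof -
  have F: "theorems F \<subseteq> statements F" "\<And>s. s \<in> statements F \<Longrightarrow> negation F s \<in> statements F"
    using assms(1) unfolding formal_system_def by auto
  from assms(2) obtain neg where inj: "inj_on gn (statements F)"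
    and neg_pr: "primitive_recursive1 neg"
    and neg: "\<And>s. s \<in> statements F \<Longrightarrow> neg (gn s) = gn (negation F s)"
    unfolding goedel_numbering_def by blast
  have phi_pr: "primitive_recursive1 \<phi>" and range: "range \<phi> = gn ` theorems F"
    using assms(4) unfolding enumerates_theorems_def by auto
  have E: "primitive_recursive1 (\<lambda>n. fst (E n))" "primitive_recursive1 (\<lambda>n. snd (E n))"
    using assms(5) unfolding primitive_recursive_pairing_def by auto
  define u where "u n = \<phi> (fst (E n))" for n
  define v where "v n = neg (\<phi> (snd (E n)))" for n
  define G where "G m n = (if u n = v n then (m div 2 ^ n) mod 2 else 0)" for m n :: nat
  note computable = E[THEN primitive_recursive1_imp_computable]
    phi_pr[THEN primitive_recursive1_imp_computable]
    neg_pr[THEN primitive_recursive1_imp_computable]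
  have "total_computable2 G"
    unfolding G_def u_def v_def
    by (intro computable_digit_if_eq computable_comp1[OF computable(3)]
        computable_comp1[OF computable(4)] computable(1,2))
  moreover have "G m n \<in> {0, 1}" for m n
    by (auto simp: G_def)
  moreover have "G_class F gn \<phi> E = {(\<lambda>n. G m n) | m. True}"
  proof -
    \<comment> \<open>\<open>statement_of\<close> is an inverse only on Goedel numbers of
      statements; every value of \<open>\<phi>\<close> is one, as theorems are statements.\<close>
    have statement_of: "statement_of F gn (\<phi> k) \<in> statements F"
      "gn (statement_of F gn (\<phi> k)) = \<phi> k" for k
    proof -
      have "\<phi> k \<in> gn ` statements F" using range F(1) by blast
      then show "statement_of F gn (\<phi> k) \<in> statements F" "gn (statement_of F gn (\<phi> k)) = \<phi> k"
        unfolding statement_of_def by (simp_all add: inv_into_into f_inv_into_f)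
    qed
    \<comment> \<open>Injectivity of \<open>gn\<close> turns equality of statements into equality of
      numbers. Closure under negation puts the right-hand side in the set on which \<open>gn\<close>
      is injective.\<close>
    have "statement_of F gn (\<phi> i) = negation F (statement_of F gn (\<phi> j)) \<longleftrightarrow> \<phi> i = neg (\<phi> j)"
      for i j
      using inj_on_eq_iff[OF inj statement_of(1)[of i] F(2)[OF statement_of(1)[of j]]]
        neg[OF statement_of(1)[of j]] by (simp add: statement_of(2))
    then have "g_fun F gn \<phi> E (\<lambda>n. (m div 2 ^ n) mod 2) = G m" for m
      by (auto simp: g_fun_def G_def u_def v_def)
    then show ?thesis
      unfolding G_class_def finitely_supported_01_eq_digits by (auto; metis rangeI)
  qed
  ultimately show ?thesis
    unfolding computable_function_class_def by blast
qed

end
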